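(* Let $r\ge 1$ and let the function $f\colon\mathbb R^d\to\mathbb R$ be $r$-times differentiable at $\boldsymbol c\in\mathbb R^d$. (i) If $\boldsymbol u\in\mathbb R^d$, then the $r$th order differential of $f$ at $\boldsymbol c$ with increment $\boldsymbol u$ is given by $\mathsf d^r f(\boldsymbol c;\boldsymbol u)=\mathsf D^{\otimes r}f(\boldsymbol c)^\top\boldsymbol u^{\otimes r}$. (ii) If $\boldsymbol a\in\mathbb R^{d^r}$ satisfies $\mathsf d^r f(\boldsymbol c;\boldsymbol u)=\boldsymbol a^\top\boldsymbol u^{\otimes r}$ for all $\boldsymbol u\in\mathbb R^d$, then $\mathsf D^{\otimes r}f(\boldsymbol c)=\boldsymbol{\mathcal S}_{d,r}\boldsymbol a$.
   Context: Vectors are column vectors; $\otimes$ is the Kronecker product, and $\boldsymbol A^{\otimes r}$ is the $r$-fold Kronecker power ($\boldsymbol A^{\otimes 1}=\boldsymbol A$, $\boldsymbol A^{\otimes 0}=1$). Differentiability: $f$ is once differentiable at $\boldsymbol c$ in the usual (Fréchet) sense; for $r>1$, $f$ is $r$ times differentiable at $\boldsymbol c$ if it is $(r-1)$ times differentiable in a neighborhood of $\boldsymbol c$ and all its partial derivatives of order $r-1$ are differentiable at $\boldsymbol c$. Differential: $\mathsf d^r f(\boldsymbol c;\boldsymbol u)=\sum_{i_1,\dots,i_r=1}^d u_{i_1}\cdots u_{i_r}\,\frac{\partial^r f}{\partial x_{i_1}\cdots\partial x_{i_r}}(\boldsymbol c)$ for $\boldsymbol u=(u_1,\dots,u_d)$.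 Vectorized derivative: $\mathsf D^{\otimes r}f(\boldsymbol c)\in\mathbb R^{d^r}$ is the formal $r$-fold Kronecker power of the column operator $\mathsf D=(\partial/\partial x_1,\dots,\partial/\partial x_d)^\top$ applied to $f$ at $\boldsymbol c$; i.e. its entry at position $1+\sum_{j=1}^r(i_j-1)d^{r-j}$ is $\frac{\partial^r f}{\partial x_{i_1}\cdots\partial x_{i_r}}(\boldsymbol c)$. Symmetrizer matrix: $\boldsymbol{\mathcal S}_{d,r}$ is the $d^r\times d^r$ matrix determined by $r!\,\boldsymbol{\mathcal S}_{d,r}(\boldsymbol v_1\otimes\cdots\otimes\boldsymbol v_r)=\sum_{\sigma\in\mathcal P_r}\boldsymbol v_{\sigma(1)}\otimes\cdots\otimes\boldsymbol v_{\sigma(r)}$ for all $\boldsymbol v_1,\dots,\boldsymbol v_r\in\mathbb R^d$, where $\mathcal P_r$ is the set of all permutations of $\{1,\dots,r\}$. *)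

theory Defs
  imports "HOL-Analysis.Analysis" "Jordan_Normal_Form.Matrix" "HOL-Combinatorics.Permutations"
begin

unbundle no inner_syntax
unbundle no vec_syntax

section \<open>Higher order partial derivatives and differentials\<close>

definition partial_deriv :: "'d::finite \<Rightarrow> (real^'d \<Rightarrow> real) \<Rightarrow> real^'d \<Rightarrow> real" where
  "partial_deriv i f x = deriv (\<lambda>t. f (x + t *\<^sub>R axis i 1)) 0"

text \<open>
  \<open>partial_derivs [i\<^sub>1, \<dots>, i\<^sub>r] f\<close> is \<open>\<partial>\<^sup>r f / (\<partial>x\<^sub>i\<^sub>1 \<cdots> \<partial>x\<^sub>i\<^sub>r)\<close>, read as
  \<open>\<partial>/\<partial>x\<^sub>i\<^sub>1 (\<cdots> (\<partial>/\<partial>x\<^sub>i\<^sub>r f))\<close>. Symmetry in the indices is not built in.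
\<close>

definition partial_derivs :: "'d::finite list \<Rightarrow> (real^'d \<Rightarrow> real) \<Rightarrow> real^'d \<Rightarrow> real" where
  "partial_derivs is f = foldr partial_deriv is f"

text \<open>
  The case \<open>0\<close> is a vacuous base case; for \<open>r = 1\<close> the definition is Frechet differentiability
  at \<open>c\<close>, see \<open>times_differentiable_at_1\<close> below.
\<close>

primrec times_differentiable_at :: "nat \<Rightarrow> (real^'d::finite \<Rightarrow> real) \<Rightarrow> real^'d \<Rightarrow> bool" where
  "times_differentiable_at 0 f c \<longleftrightarrow> True"
| "times_differentiable_at (Suc r) f c \<longleftrightarrow>
     (\<forall>\<^sub>F x in nhds c. times_differentiable_at r f x) \<and>
     (\<forall>is. length is = r \<longrightarrow> partial_derivs is f differentiable (at c))"

lemma times_differentiable_at_1: "times_differentiable_at 1 f c \<longleftrightarrow> f differentiable (at c)"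
  by (simp add: partial_derivs_def)

definition differential :: "nat \<Rightarrow> (real^'d::finite \<Rightarrow> real) \<Rightarrow> real^'d \<Rightarrow> real^'d \<Rightarrow> real" where
  "differential r f c u =
     (\<Sum>is | length is = r. (\<Prod>j<r. vec_nth u (is ! j)) * partial_derivs is f c)"

section \<open>Kronecker products of vectors\<close>

definition kron_vec :: "'a::times Matrix.vec \<Rightarrow> 'a Matrix.vec \<Rightarrow> 'a Matrix.vec" where
  "kron_vec u v =
     Matrix.vec (dim_vec u * dim_vec v) (\<lambda>p. u $ (p div dim_vec v) * v $ (p mod dim_vec v))"

definition kron_list :: "'a::comm_semiring_1 Matrix.vec list \<Rightarrow> 'a Matrix.vec" where
  "kron_list vs = foldr kron_vec vs (Matrix.vec 1 (\<lambda>_. 1))"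

definition kron_power :: "'a::comm_semiring_1 Matrix.vec \<Rightarrow> nat \<Rightarrow> 'a Matrix.vec" where
  "kron_power v r = kron_list (replicate r v)"

text \<open>
  Coordinate vector of a point of \<open>\<real>\<^sup>d\<close>, where \<open>e\<close> lists the coordinate labels in order
  (coordinate \<open>x\<^sub>i\<close> of the usual 1-based numbering is the one with label \<open>e (i - 1)\<close>).
\<close>

definition coord_vec :: "(nat \<Rightarrow> 'd::finite) \<Rightarrow> real^'d \<Rightarrow> real Matrix.vec" where
  "coord_vec e u = Matrix.vec CARD('d) (\<lambda>i. vec_nth u (e i))"

section \<open>Positions and multi-indices\<close>

text \<open>
  With all indices 0-based, the multi-index \<open>(i\<^sub>1, \<dots>, i\<^sub>r)\<close> sits at position
  \<open>\<Sum>\<^sub>j i\<^sub>j d\<^bsup>r-j\<^esup>\<close>. The function \<open>mindex d r\<close> is the inverse map (base \<open>d\<close> digits, the most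
  significant one first), see \<open>mindex_position\<close> below.
\<close>

definition mindex :: "nat \<Rightarrow> nat \<Rightarrow> nat \<Rightarrow> nat list" where
  "mindex d r p = map (\<lambda>j. p div d ^ (r - 1 - j) mod d) [0..<r]"

definition vec_deriv ::
  "(nat \<Rightarrow> 'd::finite) \<Rightarrow> nat \<Rightarrow> (real^'d \<Rightarrow> real) \<Rightarrow> real^'d \<Rightarrow> real Matrix.vec" where
  "vec_deriv e r f c =
     Matrix.vec (CARD('d) ^ r) (\<lambda>p. partial_derivs (map e (mindex CARD('d) r p)) f c)"

section \<open>The symmetrizer matrix\<close>

definition is_symmetrizer :: "nat \<Rightarrow> nat \<Rightarrow> real mat \<Rightarrow> bool" where
  "is_symmetrizer d r S \<longleftrightarrow>
     S \<in> carrier_mat (d ^ r) (d ^ r) \<and>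
     (\<forall>vs. length vs = r \<and> set vs \<subseteq> carrier_vec d \<longrightarrow>
        fact r \<cdot>\<^sub>v (S *\<^sub>v kron_list vs) =
        finsum_vec TYPE(real) (d ^ r) (\<lambda>\<sigma>. kron_list (map (\<lambda>j. vs ! \<sigma> j) [0..<r]))
          {\<sigma>. \<sigma> permutes {..<r}})"

text \<open>Well-defined by \<open>ex1_symmetrizer\<close> below.\<close>

definition symmetrizer :: "nat \<Rightarrow> nat \<Rightarrow> real mat" where
  "symmetrizer d r = (THE S. is_symmetrizer d r S)"

section \<open>Adequacy of the definitions\<close>

lemma length_mindex [simp]: "length (mindex d r p) = r"
  by (simp add: mindex_def)

lemma mindex_nth: "j < r \<Longrightarrow> mindex d r p ! j = p div d ^ (r - 1 - j) mod d"
  by (simp add: mindex_def)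

lemma mindex_Suc: "mindex d (Suc r) p = (p div d ^ r mod d) # mindex d r p"
proof (rule nth_equalityI)
  fix j assume "j < length (mindex d (Suc r) p)"
  then show "mindex d (Suc r) p ! j = ((p div d ^ r mod d) # mindex d r p) ! j"
    by (cases j) (auto simp: mindex_nth)
qed simp

lemma mindex_mod:
  assumes "d > 0" shows "mindex d r (p mod d ^ r) = mindex d r p"
proof (rule nth_equalityI)
  fix j assume "j < length (mindex d r (p mod d ^ r))"
  then have j: "j < r" by simp
  define k where "k = r - 1 - j"
  have k: "k < r" using j by (simp add: k_def)
  have "d ^ r = d ^ k * d ^ (r - k)" using k by (simp flip: power_add)
  then have "p mod d ^ r = d ^ k * (p div d ^ k mod d ^ (r - k)) + p mod d ^ k"
    by (simp add: mod_mult2_eq)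
  then have "(p mod d ^ r) div d ^ k = p div d ^ k mod d ^ (r - k)"
    using assms by simp
  moreover have "d dvd d ^ (r - k)" using k by (simp add: dvd_power)
  ultimately have "(p mod d ^ r) div d ^ k mod d = p div d ^ k mod d"
    by (simp add: mod_mod_cancel)
  then show "mindex d r (p mod d ^ r) ! j = mindex d r p ! j"
    using j by (simp add: mindex_nth k_def)
qed simp

lemma mindex_bound: "d > 0 \<Longrightarrow> set (mindex d r p) \<subseteq> {..<d}"
  by (auto simp: mindex_def)

lemma mindex_position:
  assumes "length is = r" "set is \<subseteq> {..<d}"
  shows "(\<Sum>j<r. is ! j * d ^ (r - 1 - j)) < d ^ r"
    and "mindex d r (\<Sum>j<r. is ! j * d ^ (r - 1 - j)) = is"
proof -
  have "(\<Sum>j<r. is ! j * d ^ (r - 1 - j)) < d ^ r \<and>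
        mindex d r (\<Sum>j<r. is ! j * d ^ (r - 1 - j)) = is"
    using assms
  proof (induction "is" arbitrary: r)
    case Nil
    then show ?case by (simp add: mindex_def)
  next
    case (Cons i "is")
    define s where "s = length is"
    have r: "r = Suc s" using Cons.prems by (simp add: s_def)
    define q where "q = (\<Sum>j<s. is ! j * d ^ (s - 1 - j))"
    have IH: "q < d ^ s" "mindex d s q = is"
      using Cons.IH[of s] Cons.prems by (simp_all add: s_def q_def)
    have i: "i < d" using Cons.prems by simp
    have sum: "(\<Sum>j<r. (i # is) ! j * d ^ (r - 1 - j)) = i * d ^ s + q"
      unfolding r q_def sum.lessThan_Suc_shift by simp
    have "i * d ^ s + q < Suc i * d ^ s" using IH by simp
    also have "\<dots> \<le> d * d ^ s" using i by (intro mult_right_mono) auto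
    finally have lt: "i * d ^ s + q < d ^ r" by (simp add: r)
    have "(i * d ^ s + q) mod d ^ s = q" using IH by simp
    then have "mindex d s (i * d ^ s + q) = is"
      using mindex_mod[of d s "i * d ^ s + q"] IH i by simp
    moreover have "(i * d ^ s + q) div d ^ s mod d = i" using IH i by simp
    ultimately show ?case using lt sum by (simp add: r mindex_Suc)
  qed
  then show "(\<Sum>j<r. is ! j * d ^ (r - 1 - j)) < d ^ r"
    and "mindex d r (\<Sum>j<r. is ! j * d ^ (r - 1 - j)) = is" by auto
qed

lemma vec_deriv_position:
  fixes e :: "nat \<Rightarrow> 'd::finite"
  assumes "length is = r" "set is \<subseteq> {..<CARD('d)}"
  shows "vec_deriv e r f c $ (\<Sum>j<r. is ! j * CARD('d) ^ (r - 1 - j)) =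
         partial_derivs (map e is) f c"
  using mindex_position[OF assms] by (simp add: vec_deriv_def)

lemma bij_betw_mindex:
  "bij_betw (mindex d r) {..<d ^ r} {is. set is \<subseteq> {..<d} \<and> length is = r}"
proof -
  let ?L = "{is. set is \<subseteq> {..<d} \<and> length is = r}"
  have fin: "finite ?L" by (simp add: finite_lists_length_eq)
  have card: "card ?L = d ^ r" by (simp add: card_lists_length_eq)
  have img: "mindex d r ` {..<d ^ r} = ?L"
  proof
    show "mindex d r ` {..<d ^ r} \<subseteq> ?L"
    proof
      fix "is" assume "is \<in> mindex d r ` {..<d ^ r}"
      then obtain p where p: "p < d ^ r" "is = mindex d r p" by auto
      show "is \<in> ?L"
      proof (cases "d > 0")
        case True
        then show ?thesis using p mindex_bound by simp
      next
        case False
        then have "r = 0" using p by (cases r) auto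
        then show ?thesis using p by (simp add: mindex_def)
      qed
    qed
    show "?L \<subseteq> mindex d r ` {..<d ^ r}"
    proof
      fix "is" assume "is \<in> ?L"
      then show "is \<in> mindex d r ` {..<d ^ r}"
        using mindex_position[of "is" r d] by (metis (mono_tags, lifting) mem_Collect_eq imageI lessThan_iff)
    qed
  qed
  then have "inj_on (mindex d r) {..<d ^ r}"
    using card by (intro eq_card_imp_inj_on) auto
  then show ?thesis using img by (simp add: bij_betw_def)
qed

lemma kron_list_carrier:
  "set vs \<subseteq> carrier_vec d \<Longrightarrow> kron_list vs \<in> carrier_vec (d ^ length vs)"
proof (induction vs)
  case Nil
  then show ?case by (intro carrier_vecI) (simp add: kron_list_def)
next
  case (Cons v vs)
  then have "dim_vec v = d" "dim_vec (kron_list vs) = d ^ length vs" by simp_all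
  moreover have "kron_list (v # vs) = kron_vec v (kron_list vs)" by (simp add: kron_list_def)
  ultimately show ?case by (intro carrier_vecI) (simp add: kron_vec_def)
qed

lemma kron_list_nth:
  assumes "length vs = r" "set vs \<subseteq> carrier_vec d" "p < d ^ r"
  shows "kron_list vs $ p = (\<Prod>j<r. vs ! j $ (mindex d r p ! j))"
  using assms
proof (induction vs arbitrary: r p)
  case Nil
  then show ?case by (simp add: kron_list_def)
next
  case (Cons v vs)
  define s where "s = length vs"
  have r: "r = Suc s" using Cons.prems by (simp add: s_def)
  have v: "dim_vec v = d" using Cons.prems(2) by simp
  have d: "d > 0" using Cons.prems(3) unfolding r by (cases d) simp_all
  have dim: "dim_vec (kron_list vs) = d ^ s"
    using kron_list_carrier[of vs d] Cons.prems by (simp add: s_def)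
  have p: "p < d * d ^ s" using Cons.prems by (simp add: r)
  then have pd: "p div d ^ s < d" by (simp add: less_mult_imp_div_less)
  have "kron_list (v # vs) = kron_vec v (kron_list vs)" by (simp add: kron_list_def)
  then have "kron_list (v # vs) $ p = v $ (p div d ^ s) * kron_list vs $ (p mod d ^ s)"
    using p by (simp add: kron_vec_def v dim)
  also have "kron_list vs $ (p mod d ^ s) = (\<Prod>j<s. vs ! j $ (mindex d s p ! j))"
    using Cons.IH[of s "p mod d ^ s"] Cons.prems d by (simp add: s_def mindex_mod)
  finally show ?case using pd
    unfolding r mindex_Suc prod.lessThan_Suc_shift by simp
qed

lemma kron_power_1: "kron_power v 1 = v"
proof (rule eq_vecI)
  have eq: "kron_power v 1 = kron_vec v (Matrix.vec 1 (\<lambda>_. 1))"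
    by (simp add: kron_power_def kron_list_def)
  then show "dim_vec (kron_power v 1) = dim_vec v" by (simp add: kron_vec_def)
  fix p assume "p < dim_vec v"
  then show "kron_power v 1 $ p = v $ p" unfolding eq by (simp add: kron_vec_def)
qed

lemma kron_list_unit_vecs:
  assumes "q < d ^ r"
  shows "kron_list (map (unit_vec d) (mindex d r q)) = (unit_vec (d ^ r) q :: real Matrix.vec)"
    (is "kron_list ?vs = _")
proof (rule eq_vecI)
  have car: "set ?vs \<subseteq> carrier_vec d" by auto
  show "dim_vec (kron_list ?vs) = dim_vec (unit_vec (d ^ r) q)"
    using kron_list_carrier[OF car] by simp
  fix p assume "p < dim_vec (unit_vec (d ^ r) q :: real Matrix.vec)"
  then have p: "p < d ^ r" by simp
  have b: "mindex d r x ! j < d" if "j < r" "x < d ^ r" for j x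
  proof -
    have "set (mindex d r x) \<subseteq> {..<d}"
      using bij_betw_apply[OF bij_betw_mindex, of x d r] that by simp
    moreover have "mindex d r x ! j \<in> set (mindex d r x)" using that by simp
    ultimately show ?thesis by blast
  qed
  have "kron_list ?vs $ p = (\<Prod>j<r. ?vs ! j $ (mindex d r p ! j))"
    using car p by (intro kron_list_nth) auto
  also have "\<dots> = (\<Prod>j<r. if mindex d r p ! j = mindex d r q ! j then 1 else 0)"
    using b p assms by (intro prod.cong) auto
  also have "\<dots> = (if mindex d r p = mindex d r q then 1 else 0)"
    by (auto simp: list_eq_iff_nth_eq)
  also have "\<dots> = (if p = q then 1 else 0)"
    using bij_betw_imp_inj_on[OF bij_betw_mindex, of d r] p assms by (auto dest: inj_onD)
  finally show "kron_list ?vs $ p = unit_vec (d ^ r) q $ p" using p assms by simp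
qed

lemma ex1_symmetrizer: "\<exists>!S. is_symmetrizer d r S"
proof -
  let ?n = "d ^ r"
  let ?P = "{\<sigma>. \<sigma> permutes {..<r}}"
  let ?m = "mindex d r"
  have finP: "finite ?P" by (simp add: finite_permutations)
  define S :: "real mat" where
    "S = mat ?n ?n (\<lambda>(p, q). (\<Sum>\<sigma>\<in>?P. if \<forall>j<r. ?m q ! \<sigma> j = ?m p ! j then 1 else 0) / fact r)"
  have perm_car: "kron_list (map (\<lambda>j. vs ! \<sigma> j) [0..<r]) \<in> carrier_vec ?n"
    if "length vs = r" "set vs \<subseteq> carrier_vec d" "\<sigma> \<in> ?P" for \<sigma> and vs :: "real Matrix.vec list"
  proof -
    have "\<sigma> j < r" if "j < r" for j
      using permutes_in_image[of \<sigma> "{..<r}" j] that \<open>\<sigma> \<in> ?P\<close> by simp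
    then have "set (map (\<lambda>j. vs ! \<sigma> j) [0..<r]) \<subseteq> carrier_vec d"
      using that by (auto simp: subset_iff)
    from kron_list_carrier[OF this] show ?thesis by simp
  qed
  have ex: "is_symmetrizer d r S"
    unfolding is_symmetrizer_def
  proof (intro conjI allI impI)
    show "S \<in> carrier_mat ?n ?n" by (simp add: S_def)
    fix vs :: "real Matrix.vec list" assume "length vs = r \<and> set vs \<subseteq> carrier_vec d"
    then have vs: "length vs = r" "set vs \<subseteq> carrier_vec d" by auto
    let ?R = "finsum_vec TYPE(real) ?n (\<lambda>\<sigma>. kron_list (map (\<lambda>j. vs ! \<sigma> j) [0..<r])) ?P"
    have car: "(\<lambda>\<sigma>. kron_list (map (\<lambda>j. vs ! \<sigma> j) [0..<r])) \<in> ?P \<rightarrow> carrier_vec ?n"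
      using perm_car[OF vs] by auto
    have dimR: "dim_vec ?R = ?n" using finsum_vec_closed[OF car] by simp
    show "fact r \<cdot>\<^sub>v (S *\<^sub>v kron_list vs) = ?R"
    proof (rule eq_vecI)
      show "dim_vec (fact r \<cdot>\<^sub>v (S *\<^sub>v kron_list vs)) = dim_vec ?R"
        using dimR by (simp add: S_def)
      fix p assume "p < dim_vec ?R"
      then have p: "p < ?n" using dimR by simp
      have kd: "dim_vec (kron_list vs) = ?n" using kron_list_carrier[OF vs(2)] vs by simp
      have entry: "(\<Sum>q<?n. (if \<forall>j<r. ?m q ! \<sigma> j = ?m p ! j then 1 else 0) * kron_list vs $ q) =
          kron_list (map (\<lambda>j. vs ! \<sigma> j) [0..<r]) $ p" if \<sigma>: "\<sigma> permutes {..<r}" for \<sigma>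
      proof -
        have \<sigma>r: "\<sigma> j < r" if "j < r" for j
          using permutes_in_image[OF \<sigma>, of j] that by simp
        have ir: "inv_into UNIV \<sigma> j < r" if "j < r" for j
          using permutes_in_image[OF permutes_inv[OF \<sigma>], of j] that by simp
        define is' where "is' = map (\<lambda>k. ?m p ! inv_into UNIV \<sigma> k) [0..<r]"
        have mp: "?m p \<in> {is. set is \<subseteq> {..<d} \<and> length is = r}"
          using bij_betw_apply[OF bij_betw_mindex] p by blast
        have "set is' \<subseteq> {..<d}"
          using mp ir by (fastforce simp: is'_def subset_iff)
        then have "is' \<in> {is. set is \<subseteq> {..<d} \<and> length is = r}" by (simp add: is'_def)
        then have "is' \<in> ?m ` {..<?n}"
          unfolding bij_betw_imp_surj_on[OF bij_betw_mindex] .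
        then obtain q0 where q0: "q0 < ?n" "?m q0 = is'" by force
        have iff: "(\<forall>j<r. ?m q ! \<sigma> j = ?m p ! j) \<longleftrightarrow> q = q0" if q: "q < ?n" for q
        proof -
          have "(\<forall>j<r. ?m q ! \<sigma> j = ?m p ! j) \<longleftrightarrow> (\<forall>k<r. ?m q ! k = ?m p ! inv_into UNIV \<sigma> k)"
          proof (intro iffI allI impI)
            fix k assume H: "\<forall>j<r. ?m q ! \<sigma> j = ?m p ! j" and k: "k < r"
            show "?m q ! k = ?m p ! inv_into UNIV \<sigma> k"
              using H[rule_format, OF ir[OF k]] by (simp only: permutes_inverses(1)[OF \<sigma>])
          next
            fix j assume H: "\<forall>k<r. ?m q ! k = ?m p ! inv_into UNIV \<sigma> k" and j: "j < r"
            show "?m q ! \<sigma> j = ?m p ! j"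
              using H[rule_format, OF \<sigma>r[OF j]] by (simp only: permutes_inverses(2)[OF \<sigma>])
          qed
          also have "\<dots> \<longleftrightarrow> ?m q = is'"
            by (auto simp: list_eq_iff_nth_eq is'_def)
          also have "\<dots> \<longleftrightarrow> q = q0"
            using bij_betw_imp_inj_on[OF bij_betw_mindex, of d r] q q0 by (auto dest: inj_onD)
          finally show ?thesis .
        qed
        have "(\<Sum>q<?n. (if \<forall>j<r. ?m q ! \<sigma> j = ?m p ! j then 1 else 0) * kron_list vs $ q) =
            (\<Sum>q<?n. if q = q0 then kron_list vs $ q else 0)"
          using iff by (intro sum.cong) auto
        also have "\<dots> = kron_list vs $ q0" using q0 by simp
        also have "\<dots> = (\<Prod>k<r. vs ! k $ (?m q0 ! k))"
          using vs q0 by (intro kron_list_nth)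
        also have "\<dots> = (\<Prod>j<r. vs ! \<sigma> j $ (?m q0 ! \<sigma> j))"
          using prod.permute[OF \<sigma>, of "\<lambda>k. vs ! k $ (?m q0 ! k)"] by simp
        also have "\<dots> = (\<Prod>j<r. map (\<lambda>j. vs ! \<sigma> j) [0..<r] ! j $ (?m p ! j))"
          using iff[OF q0(1)] by (intro prod.cong) auto
        also have "\<dots> = kron_list (map (\<lambda>j. vs ! \<sigma> j) [0..<r]) $ p"
          using \<sigma>r vs p by (intro kron_list_nth[symmetric]) (auto simp: subset_iff)
        finally show ?thesis .
      qed
      have "(fact r \<cdot>\<^sub>v (S *\<^sub>v kron_list vs)) $ p =
          fact r * (\<Sum>q<?n. S $$ (p, q) * kron_list vs $ q)"
        using p kd by (simp add: S_def scalar_prod_def lessThan_atLeast0)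
      also have "\<dots> = (\<Sum>q<?n. \<Sum>\<sigma>\<in>?P.
          (if \<forall>j<r. ?m q ! \<sigma> j = ?m p ! j then 1 else 0) * kron_list vs $ q)"
        unfolding sum_distrib_left
        using p by (intro sum.cong refl) (simp add: S_def sum_distrib_right)
      also have "\<dots> = (\<Sum>\<sigma>\<in>?P. \<Sum>q<?n.
          (if \<forall>j<r. ?m q ! \<sigma> j = ?m p ! j then 1 else 0) * kron_list vs $ q)"
        by (rule sum.swap)
      also have "\<dots> = (\<Sum>\<sigma>\<in>?P. kron_list (map (\<lambda>j. vs ! \<sigma> j) [0..<r]) $ p)"
        using entry by (intro sum.cong) auto
      also have "\<dots> = ?R $ p"
        by (rule index_finsum_vec[OF finP p car, symmetric])
      finally show "(fact r \<cdot>\<^sub>v (S *\<^sub>v kron_list vs)) $ p = ?R $ p" .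
    qed
  qed
  have uniq: "T = U" if T: "is_symmetrizer d r T" and U: "is_symmetrizer d r U" for T U
  proof (rule eq_matI)
    have carT: "T \<in> carrier_mat ?n ?n" and carU: "U \<in> carrier_mat ?n ?n"
      using T U by (auto simp: is_symmetrizer_def)
    then show "dim_row T = dim_row U" "dim_col T = dim_col U" by auto
    fix i q assume "i < dim_row U" "q < dim_col U"
    then have i: "i < ?n" and q: "q < ?n" using carU by auto
    let ?vs = "map (unit_vec d) (?m q) :: real Matrix.vec list"
    have "length ?vs = r \<and> set ?vs \<subseteq> carrier_vec d" by auto
    then have "fact r \<cdot>\<^sub>v (T *\<^sub>v kron_list ?vs) = fact r \<cdot>\<^sub>v (U *\<^sub>v kron_list ?vs)"
      using T U unfolding is_symmetrizer_def by metis
    then have "(fact r \<cdot>\<^sub>v (T *\<^sub>v unit_vec ?n q)) $ i = (fact r \<cdot>\<^sub>v (U *\<^sub>v unit_vec ?n q)) $ i"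
      by (simp add: kron_list_unit_vecs[OF q])
    then show "T $$ (i, q) = U $$ (i, q)"
      using carT carU i q by simp
  qed
  show ?thesis using ex uniq by blast
qed

end

theory Submission
  imports Defs
begin

text \<open>
  Both the differential and a dot product \<open>a \<bullet> kron_power u r\<close> are values of a form
  \<open>q\<^sub>B u = \<Sum>\<^bsub>i\<^sub>1,\<dots>,i\<^sub>r\<^esub> B [i\<^sub>1, \<dots>, i\<^sub>r] * u\<^sub>i\<^sub>1 * \<dots> * u\<^sub>i\<^sub>r\<close>: for the differential, \<open>B\<close> is the
  array \<open>H\<close> of partial derivatives of order \<open>r\<close> at \<open>c\<close>, and for the dot product it is the array
  \<open>A\<close> of entries of \<open>a\<close>, listed by multi-index instead of by position. Part (i) is therefore a
  reindexing of a sum (\<open>scalar_prod_kron_power\<close>).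

  In part (ii), the difference \<open>B = H - A\<close> satisfies \<open>q\<^sub>B = 0\<close>. A form does not determine its coefficient
  array, but by polarization it determines the average of the array over permutations of the
  indices: the symmetrization of \<open>B\<close> vanishes, so
  \<open>\<Sum>\<^sub>\<sigma> A (i \<circ> \<sigma>) = \<Sum>\<^sub>\<sigma> H (i \<circ> \<sigma>)\<close> for every multi-index \<open>i\<close>
  (\<open>symmetrization_zero_if_diagonal_zero\<close>). The left-hand side is \<open>r!\<close> times the entry of the
  symmetrizer applied to \<open>a\<close> (\<open>symmetrizer_mult_vec\<close>), and the right-hand side is \<open>r! * H i\<close>
  because \<open>H\<close> is symmetric.

  The symmetry of \<open>H\<close> (\<open>partial_derivs_mset_cong\<close>) is the analytic content. The partial
  derivatives of order \<open>r\<close> exist at \<open>c\<close> but need not be continuous there, so it rests on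
  Young's form of the theorem on mixed partial derivatives (\<open>partial_deriv_commute\<close>), which asks
  of the first partial derivatives only that they be differentiable at the point.
\<close>

section \<open>Symmetry of higher order partial derivatives\<close>

lemma has_real_derivative_along_line:
  fixes g :: "'a::real_normed_vector \<Rightarrow> real"
  assumes "(g has_derivative g') (at (x + s *\<^sub>R v))"
  shows "((\<lambda>t. g (x + t *\<^sub>R v)) has_real_derivative g' v) (at s)"
proof -
  interpret g': bounded_linear g' using assms by (rule has_derivative_bounded_linear)
  have "((\<lambda>t. x + t *\<^sub>R v) has_derivative (\<lambda>h. h *\<^sub>R v)) (at s)"
    by (auto intro!: derivative_eq_intros)
  from has_derivative_compose[OF this assms]
  have "((\<lambda>t. g (x + t *\<^sub>R v)) has_derivative (\<lambda>h. g' (h *\<^sub>R v))) (at s)" .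
  moreover have "(\<lambda>h. g' (h *\<^sub>R v)) = (*) (g' v)"
    by (simp add: fun_eq_iff g'.scaleR mult.commute)
  ultimately show ?thesis by (simp add: has_field_derivative_def)
qed

lemma partial_deriv_eq:
  fixes g :: "real^'d::finite \<Rightarrow> real"
  assumes "(g has_derivative g') (at x)"
  shows "partial_deriv i g x = g' (axis i 1)"
  unfolding partial_deriv_def
  by (rule DERIV_imp_deriv, rule has_real_derivative_along_line) (simp add: assms)

lemma has_real_derivative_partial_deriv:
  fixes g :: "real^'d::finite \<Rightarrow> real"
  assumes "g differentiable (at (x + s *\<^sub>R axis i 1))"
  shows "((\<lambda>s. g (x + s *\<^sub>R axis i 1)) has_real_derivative
           partial_deriv i g (x + s *\<^sub>R axis i 1)) (at s)"
proof -
  obtain g' where g': "(g has_derivative g') (at (x + s *\<^sub>R axis i 1))"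
    using assms by (auto simp: differentiable_def)
  show ?thesis
    unfolding partial_deriv_eq[OF g'] by (rule has_real_derivative_along_line[OF g'])
qed

text \<open>
  The second difference quotient is symmetric in the two directions, while its limit is a mixed
  partial derivative taken in one definite order. Applying the mean value theorem along
  \<open>axis i 1\<close> to the difference of \<open>g\<close> on two parallel segments turns the second difference into
  \<open>t\<close> times an increment of \<open>partial_deriv i g\<close>, and differentiability of that
  function at \<open>c\<close> evaluates the increment up to \<open>o(t)\<close>.
\<close>

lemma second_difference_limit:
  fixes g :: "real^'d::finite \<Rightarrow> real"
  assumes g: "\<forall>\<^sub>F x in nhds c. g differentiable (at x)"
    and p: "partial_deriv i g differentiable (at c)"
  shows "((\<lambda>t. (g (c + t *\<^sub>R axis i 1 + t *\<^sub>R axis j 1) - g (c + t *\<^sub>R axis i 1)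
                - g (c + t *\<^sub>R axis j 1) + g c) / t\<^sup>2)
          \<longlongrightarrow> partial_deriv j (partial_deriv i g) c) (at_right 0)"
proof -
  let ?a = "axis i 1 :: real^'d" and ?b = "axis j 1 :: real^'d"
  define p where "p = partial_deriv i g"
  obtain p' where p': "(p has_derivative p') (at c)"
    using assms(2) by (auto simp: differentiable_def p_def)
  interpret p': bounded_linear p' using p' by (rule has_derivative_bounded_linear)
  have pj: "partial_deriv j p c = p' ?b" by (rule partial_deriv_eq[OF p'])
  show ?thesis
    unfolding p_def[symmetric] pj
  proof (rule tendstoI)
    fix \<epsilon> :: real assume "\<epsilon> > 0"
    \<comment> \<open>The two ends of the increment lie within \<open>2 * t\<close> and \<open>t\<close> of \<open>c\<close>, so the total error
      is at most \<open>3 * \<eta> * t\<close>; a quarter of \<open>\<epsilon>\<close> keeps it strictly below \<open>\<epsilon> * t\<close>.\<close>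
    define \<eta> where "\<eta> = \<epsilon> / 4"
    have "\<eta> > 0" using \<open>\<epsilon> > 0\<close> by (simp add: \<eta>_def)
    then obtain \<delta>1 where \<delta>1: "\<delta>1 > 0"
      "\<And>y. norm (y - c) < \<delta>1 \<Longrightarrow> \<bar>p y - p c - p' (y - c)\<bar> \<le> \<eta> * norm (y - c)"
      using p' unfolding has_derivative_at_alt by (metis real_norm_def)
    obtain \<delta>2 where \<delta>2: "\<delta>2 > 0" "\<And>y. dist y c < \<delta>2 \<Longrightarrow> g differentiable (at y)"
      using g unfolding eventually_nhds_metric by blast
    define \<delta> where "\<delta> = min \<delta>1 \<delta>2 / 2"
    have "\<delta> > 0" using \<delta>1 \<delta>2 by (simp add: \<delta>_def)
    show "\<forall>\<^sub>F t in at_right 0. dist ((g (c + t *\<^sub>R ?a + t *\<^sub>R ?b) - g (c + t *\<^sub>R ?a)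
                - g (c + t *\<^sub>R ?b) + g c) / t\<^sup>2) (p' ?b) < \<epsilon>"
      unfolding eventually_at_right_field
    proof (intro exI conjI allI impI)
      show "0 < \<delta>" by fact
      fix t :: real assume t: "0 < t" "t < \<delta>"
      have n1: "norm (z *\<^sub>R ?a + t *\<^sub>R ?b) \<le> 2 * t" if "0 \<le> z" "z \<le> t" for z
        using norm_triangle_ineq[of "z *\<^sub>R ?a" "t *\<^sub>R ?b"] that by (simp add: norm_axis_1)
      have n2: "norm (z *\<^sub>R ?a) \<le> t" if "0 \<le> z" "z \<le> t" for z
        using that by (simp add: norm_axis_1)
      define \<phi> where "\<phi> = (\<lambda>s. g ((c + t *\<^sub>R ?b) + s *\<^sub>R ?a) - g (c + s *\<^sub>R ?a))"
      have der: "(\<phi> has_real_derivative p ((c + t *\<^sub>R ?b) + z *\<^sub>R ?a) - p (c + z *\<^sub>R ?a)) (at z)"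
        if z: "0 \<le> z" "z \<le> t" for z
        unfolding \<phi>_def p_def
      proof (intro DERIV_diff has_real_derivative_partial_deriv \<delta>2)
        show "dist (c + t *\<^sub>R ?b + z *\<^sub>R ?a) c < \<delta>2"
          using n1[OF z] t by (simp add: dist_norm \<delta>_def add.commute)
        show "dist (c + z *\<^sub>R ?a) c < \<delta>2"
          using n2[OF z] t by (simp add: dist_norm \<delta>_def)
      qed
      obtain z where z: "0 < z" "z < t"
        "\<phi> t - \<phi> 0 = (t - 0) * (p ((c + t *\<^sub>R ?b) + z *\<^sub>R ?a) - p (c + z *\<^sub>R ?a))"
        using MVT2[OF t(1) der] by blast
      define D where "D = p ((c + t *\<^sub>R ?b) + z *\<^sub>R ?a) - p (c + z *\<^sub>R ?a)"
      have e1: "\<bar>p ((c + t *\<^sub>R ?b) + z *\<^sub>R ?a) - p c - p' (z *\<^sub>R ?a + t *\<^sub>R ?b)\<bar> \<le> \<eta> * (2 * t)"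
      proof -
        have eq: "(c + t *\<^sub>R ?b) + z *\<^sub>R ?a - c = z *\<^sub>R ?a + t *\<^sub>R ?b" by simp
        have "norm (z *\<^sub>R ?a + t *\<^sub>R ?b) < \<delta>1"
          using n1[of z] z t by (simp add: \<delta>_def)
        then have "\<bar>p ((c + t *\<^sub>R ?b) + z *\<^sub>R ?a) - p c - p' (z *\<^sub>R ?a + t *\<^sub>R ?b)\<bar>
            \<le> \<eta> * norm (z *\<^sub>R ?a + t *\<^sub>R ?b)"
          using \<delta>1(2)[of "(c + t *\<^sub>R ?b) + z *\<^sub>R ?a"] unfolding eq by simp
        also have "\<dots> \<le> \<eta> * (2 * t)"
          using n1[of z] z \<open>\<eta> > 0\<close> by (intro mult_left_mono) auto
        finally show ?thesis .
      qed
      have e2: "\<bar>p (c + z *\<^sub>R ?a) - p c - p' (z *\<^sub>R ?a)\<bar> \<le> \<eta> * t"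
      proof -
        have "norm (z *\<^sub>R ?a) < \<delta>1"
          using n2[of z] z t \<delta>1(1) by (simp add: \<delta>_def)
        then have "\<bar>p (c + z *\<^sub>R ?a) - p c - p' (z *\<^sub>R ?a)\<bar> \<le> \<eta> * norm (z *\<^sub>R ?a)"
          using \<delta>1(2)[of "c + z *\<^sub>R ?a"] by simp
        also have "\<dots> \<le> \<eta> * t"
          using n2[of z] z \<open>\<eta> > 0\<close> by (intro mult_left_mono) auto
        finally show ?thesis .
      qed
      have e3: "\<bar>D - t * p' ?b\<bar> \<le> 3 * \<eta> * t"
        using e1 e2 unfolding D_def by (simp add: p'.add p'.scaleR)
      have "g (c + t *\<^sub>R ?a + t *\<^sub>R ?b) - g (c + t *\<^sub>R ?a) - g (c + t *\<^sub>R ?b) + g c = t * D"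
        using z(3) unfolding \<phi>_def D_def[symmetric] by (simp add: add_ac)
      moreover have "t * D / t\<^sup>2 - p' ?b = (D - t * p' ?b) / t"
        using t by (simp add: field_simps power2_eq_square)
      moreover have "\<bar>(D - t * p' ?b) / t\<bar> < \<epsilon>"
      proof -
        have "\<bar>(D - t * p' ?b) / t\<bar> \<le> 3 * \<eta>"
          using e3 t by (simp add: divide_le_eq)
        also have "3 * \<eta> < \<epsilon>" using \<open>\<epsilon> > 0\<close> by (simp add: \<eta>_def)
        finally show ?thesis .
      qed
      ultimately show "dist ((g (c + t *\<^sub>R ?a + t *\<^sub>R ?b) - g (c + t *\<^sub>R ?a)
                - g (c + t *\<^sub>R ?b) + g c) / t\<^sup>2) (p' ?b) < \<epsilon>"
        by (simp add: dist_real_def)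
    qed
  qed
qed

text \<open>
  Young's theorem: both orders of differentiation are limits of the same second difference quotient.
\<close>

lemma partial_deriv_commute:
  fixes g :: "real^'d::finite \<Rightarrow> real"
  assumes "\<forall>\<^sub>F x in nhds c. g differentiable (at x)"
    and "partial_deriv i g differentiable (at c)"
    and "partial_deriv j g differentiable (at c)"
  shows "partial_deriv i (partial_deriv j g) c = partial_deriv j (partial_deriv i g) c"
proof (rule tendsto_unique[OF trivial_limit_at_right_real])
  let ?a = "axis i 1 :: real^'d" and ?b = "axis j 1 :: real^'d"
  let ?\<Delta> = "\<lambda>t. (g (c + t *\<^sub>R ?a + t *\<^sub>R ?b) - g (c + t *\<^sub>R ?a) - g (c + t *\<^sub>R ?b) + g c) / t\<^sup>2"
  show "(?\<Delta> \<longlongrightarrow> partial_deriv j (partial_deriv i g) c) (at_right 0)"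
    using assms by (intro second_difference_limit)
  have "?\<Delta> = (\<lambda>t. (g (c + t *\<^sub>R ?b + t *\<^sub>R ?a) - g (c + t *\<^sub>R ?b) - g (c + t *\<^sub>R ?a) + g c) / t\<^sup>2)"
    by (simp add: add_ac diff_diff_add algebra_simps)
  then show "(?\<Delta> \<longlongrightarrow> partial_deriv i (partial_deriv j g) c) (at_right 0)"
    using second_difference_limit[of g c j i] assms by simp
qed

lemma partial_deriv_cong_nhds:
  fixes g h :: "real^'d::finite \<Rightarrow> real"
  assumes "\<forall>\<^sub>F x in nhds c. g x = h x"
  shows "partial_deriv i g c = partial_deriv i h c"
proof -
  have "((\<lambda>t. c + t *\<^sub>R axis i 1) \<longlongrightarrow> c) (nhds (0::real))"
    by (auto intro!: tendsto_eq_intros filterlim_ident)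
  then have "\<forall>\<^sub>F t in nhds (0::real). g (c + t *\<^sub>R axis i 1) = h (c + t *\<^sub>R axis i 1)"
    by (rule eventually_compose_filterlim[OF assms])
  then show ?thesis unfolding partial_deriv_def by (intro deriv_cong_ev refl)
qed

lemma partial_derivs_Cons: "partial_derivs (i # is) f = partial_deriv i (partial_derivs is f)"
  by (simp add: partial_derivs_def)

text \<open>
  Two lists with the same multiset and different heads \<open>i\<close> and \<open>j\<close> can be rearranged, behind
  their heads, to \<open>i # j # ks\<close> and \<open>j # i # ks\<close>. The induction hypothesis rearranges a tail at
  all points near \<open>c\<close>, so it may be used under the outermost partial derivative; the exchange
  of the two heads is Young's theorem for \<open>partial_derivs ks f\<close>.
\<close>

lemma partial_derivs_mset_cong:
  fixes f :: "real^'d::finite \<Rightarrow> real"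
  assumes "times_differentiable_at r f c" "length is = r" "mset is = mset js"
  shows "partial_derivs is f c = partial_derivs js f c"
  using assms
proof (induction r arbitrary: c "is" js)
  case 0
  then show ?case by simp
next
  case (Suc r)
  have near: "\<forall>\<^sub>F x in nhds c. times_differentiable_at r f x"
    using Suc.prems(1) by simp
  have tail: "partial_derivs (k # ks) f c = partial_derivs (k # ls) f c"
    if "length ks = r" "mset ks = mset ls" for k ks ls
    unfolding partial_derivs_Cons
    using near by (intro partial_deriv_cong_nhds, elim eventually_mono) (rule Suc.IH[OF _ that])
  obtain i is' where is': "is = i # is'" using Suc.prems(2) by (cases "is") auto
  have "js \<noteq> []" using Suc.prems(3) is' by auto
  then obtain j js' where js': "js = j # js'" by (cases js) auto
  have len: "length is' = r" "length js' = r"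
    using Suc.prems is' js' mset_eq_length[OF Suc.prems(3)] by auto
  show ?case
  proof (cases "i = j")
    case True
    then show ?thesis
      using tail[of is' js' i] len Suc.prems(3) is' js' by simp
  next
    case False
    have eq: "add_mset i (mset is') = add_mset j (mset js')"
      using Suc.prems(3) is' js' by simp
    then obtain K where K: "mset is' = add_mset j K" "mset js' = add_mset i K"
      using False by (metis add_eq_conv_ex)
    obtain ks where ks: "mset ks = K" using ex_mset by blast
    have "size (mset is') = Suc (size K)" using K by simp
    then obtain s where s: "r = Suc s" "length ks = s" using len ks by auto
    have "\<forall>\<^sub>F x in nhds c. partial_derivs ks f differentiable (at x)"
      using near by (rule eventually_mono) (use s in auto)
    moreover have "partial_deriv k (partial_derivs ks f) differentiable (at c)" for k
      using Suc.prems(1) s unfolding partial_derivs_Cons[symmetric] by simp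
    ultimately have "partial_derivs (i # j # ks) f c = partial_derivs (j # i # ks) f c"
      unfolding partial_derivs_Cons by (intro partial_deriv_commute)
    moreover have "partial_derivs is f c = partial_derivs (i # j # ks) f c"
      unfolding is' using K ks len by (intro tail) auto
    moreover have "partial_derivs (j # i # ks) f c = partial_derivs js f c"
      unfolding js' using K ks s by (intro tail) auto
    ultimately show ?thesis by simp
  qed
qed

section \<open>Polarization\<close>

text \<open>
  A surjection of a finite set onto itself is a bijection. As a function on the whole type, a
  permutation is the identity outside \<open>R\<close>, whereas the members of \<open>R \<rightarrow>\<^sub>E R\<close> are undefined there;
  hence the requirement that \<open>F\<close> look only at values on \<open>R\<close>.
\<close>

lemma sum_permutes_eq_sum_surjections:
  fixes F :: "('a \<Rightarrow> 'a) \<Rightarrow> 'b::comm_monoid_add"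
  assumes "finite R" and F: "\<And>g h. (\<And>x. x \<in> R \<Longrightarrow> g x = h x) \<Longrightarrow> F g = F h"
  shows "(\<Sum>\<sigma> | \<sigma> permutes R. F \<sigma>) = (\<Sum>g | g \<in> R \<rightarrow>\<^sub>E R \<and> g ` R = R. F g)"
proof (rule sum.reindex_bij_witness[where i = "\<lambda>g x. if x \<in> R then g x else x" and j = "\<lambda>\<sigma>. restrict \<sigma> R"])
  fix g assume g: "g \<in> {g \<in> R \<rightarrow>\<^sub>E R. g ` R = R}"
  let ?s = "\<lambda>x. if x \<in> R then g x else x"
  show "restrict ?s R = g" using g by (auto simp: fun_eq_iff PiE_def extensional_def)
  have "inj_on g R" using g \<open>finite R\<close> by (intro eq_card_imp_inj_on) auto
  then have "bij_betw ?s R R" using g by (simp add: bij_betw_def inj_on_def)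
  then show "?s \<in> {\<sigma>. \<sigma> permutes R}" by (simp add: bij_imp_permutes)
next
  fix \<sigma> assume "\<sigma> \<in> {\<sigma>. \<sigma> permutes R}"
  then have \<sigma>: "\<sigma> permutes R" by simp
  show "(\<lambda>x. if x \<in> R then restrict \<sigma> R x else x) = \<sigma>"
    using \<sigma> by (auto simp: fun_eq_iff permutes_not_in)
  show "restrict \<sigma> R \<in> {g \<in> R \<rightarrow>\<^sub>E R. g ` R = R}"
    using permutes_image[OF \<sigma>] permutes_in_image[OF \<sigma>] by auto
  show "F (restrict \<sigma> R) = F \<sigma>" by (rule F) simp
qed

text \<open>
  Evaluating the form at \<open>u = \<Sum>\<^bsub>t\<in>T\<^esub> e\<^bsub>is!t\<^esub>\<close>, a sum of coordinate vectors, and expanding gives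
  the sum of \<open>B (is \<circ> g)\<close> over all maps \<open>g\<close> from the \<open>r\<close> positions to \<open>T\<close>. This
  is zero for every \<open>T\<close>, so Moebius inversion over the possible images of \<open>g\<close> shows that the
  maps with any given image also contribute zero. The maps whose image is the set of all positions
  are the permutations.
\<close>

lemma symmetrization_zero_if_diagonal_zero:
  fixes B :: "'a::finite list \<Rightarrow> real"
  assumes zero: "\<And>u :: 'a \<Rightarrow> real. (\<Sum>js | length js = r. (\<Prod>j<r. u (js ! j)) * B js) = 0"
    and len: "length is = r"
  shows "(\<Sum>\<sigma> | \<sigma> permutes {..<r}. B (permute_list \<sigma> is)) = 0"
proof -
  let ?R = "{..<r}"
  define F where "F g = B (map (\<lambda>k. is ! g k) [0..<r])" for g
  define Q where "Q T = (\<Sum>g \<in> ?R \<rightarrow>\<^sub>E T. F g)" for T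
  define P where "P U = (\<Sum>g | g \<in> ?R \<rightarrow>\<^sub>E U \<and> g ` ?R = U. F g)" for U
  have fin: "finite {js :: 'a list. length js = r}"
    using finite_lists_length_eq[of "UNIV :: 'a set" r] by simp
  have Q0: "Q T = 0" if "finite T" for T
  proof -
    \<comment> \<open>A label that occurs at several positions of \<open>T\<close> is counted once for each of them.\<close>
    define u :: "'a \<Rightarrow> real" where "u x = (\<Sum>t\<in>T. if x = is ! t then 1 else 0)" for x
    have "(\<Sum>js | length js = r. (\<Prod>j<r. u (js ! j)) * B js) =
        (\<Sum>js | length js = r. \<Sum>g \<in> ?R \<rightarrow>\<^sub>E T.
          (\<Prod>j<r. if js ! j = is ! g j then 1 else 0) * B js)"
      unfolding u_def using that by (simp add: prod_sum_PiE sum_distrib_right)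
    also have "\<dots> = (\<Sum>g \<in> ?R \<rightarrow>\<^sub>E T. \<Sum>js | length js = r.
          (\<Prod>j<r. if js ! j = is ! g j then 1 else 0) * B js)"
      by (rule sum.swap)
    also have "\<dots> = Q T"
      unfolding Q_def
    proof (rule sum.cong[OF refl])
      fix g
      let ?l = "map (\<lambda>k. is ! g k) [0..<r]"
      have "(\<Sum>js | length js = r. (\<Prod>j<r. if js ! j = is ! g j then 1 else 0) * B js) =
          (\<Sum>js | length js = r. if js = ?l then B js else 0)"
        by (intro sum.cong refl) (auto simp: list_eq_iff_nth_eq)
      also have "\<dots> = F g" using fin by (simp add: F_def)
      finally show "(\<Sum>js | length js = r. (\<Prod>j<r. if js ! j = is ! g j then 1 else 0) * B js) = F g" .
    qed
    finally show ?thesis using zero[of u] by simp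
  qed
  have QP: "Q T = sum P (Pow T)" if T: "finite T" for T
  proof -
    have "Q T = (\<Sum>U \<in> Pow T. \<Sum>g | g \<in> ?R \<rightarrow>\<^sub>E T \<and> g ` ?R = U. F g)"
      unfolding Q_def using T
      by (intro sum.group[symmetric] finite_PiE) auto
    also have "\<dots> = sum P (Pow T)"
      unfolding P_def by (intro sum.cong refl) (auto simp: PiE_def Pi_def)
    finally show ?thesis .
  qed
  have "P ?R = (\<Sum>T \<in> Pow ?R. (-1) ^ (card ?R - card T) * Q T)"
    using QP by (intro inclusion_exclusion_mobius) auto
  also have "\<dots> = 0"
    using Q0 by (intro sum.neutral) (auto intro: finite_subset)
  finally have "P ?R = 0" .
  moreover have "(\<Sum>\<sigma> | \<sigma> permutes ?R. F \<sigma>) = P ?R"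
    unfolding P_def
    by (rule sum_permutes_eq_sum_surjections) (auto simp: F_def intro!: arg_cong[of _ _ B])
  ultimately show ?thesis using len by (simp add: F_def permute_list_def)
qed

section \<open>Multi-indices and the symmetrizer\<close>

lemma bij_betw_map_mindex:
  fixes e :: "nat \<Rightarrow> 'd::finite"
  assumes "bij_betw e {..<CARD('d)} (UNIV :: 'd set)"
  shows "bij_betw (\<lambda>p. map e (mindex CARD('d) r p)) {..<CARD('d) ^ r} {is. length is = r}"
proof -
  have "bij_betw (map e) (lists {..<CARD('d)}) (lists UNIV)"
    using assms by (rule bij_lists)
  then have inj: "inj_on (map e) (lists {..<CARD('d)})" and img: "map e ` lists {..<CARD('d)} = UNIV"
    by (auto simp: bij_betw_def)
  let ?L = "{is. set is \<subseteq> {..<CARD('d)} \<and> length is = r}"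
  have "bij_betw (map e) ?L {is. length is = r}"
    unfolding bij_betw_def
  proof
    show "inj_on (map e) ?L" by (rule inj_on_subset[OF inj]) auto
    show "map e ` ?L = {is. length is = r}"
    proof (intro equalityI subsetI)
      fix "is" :: "'d list" assume "is \<in> {is. length is = r}"
      moreover obtain js where "js \<in> lists {..<CARD('d)}" "is = map e js" using img by blast
      ultimately show "is \<in> map e ` ?L" by (auto simp: in_lists_conv_set)
    qed auto
  qed
  from bij_betw_trans[OF bij_betw_mindex this] show ?thesis by (simp add: comp_def)
qed

lemma scalar_prod_kron_power:
  fixes e :: "nat \<Rightarrow> 'd::finite" and u :: "real^'d"
  assumes e: "bij_betw e {..<CARD('d)} (UNIV :: 'd set)"
    and a: "a \<in> carrier_vec (CARD('d) ^ r)"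
    and A: "\<And>p. p < CARD('d) ^ r \<Longrightarrow> a $ p = A (map e (mindex CARD('d) r p))"
  shows "a \<bullet> kron_power (coord_vec e u) r = (\<Sum>is | length is = r. (\<Prod>j<r. vec_nth u (is ! j)) * A is)"
proof -
  let ?n = "CARD('d)"
  let ?vs = "replicate r (coord_vec e u)"
  have vs: "length ?vs = r" "set ?vs \<subseteq> carrier_vec ?n" by (auto simp: coord_vec_def)
  have "kron_power (coord_vec e u) r \<in> carrier_vec (?n ^ r)"
    using kron_list_carrier[OF vs(2)] by (simp add: kron_power_def)
  then have "a \<bullet> kron_power (coord_vec e u) r = (\<Sum>p<?n ^ r. a $ p * kron_power (coord_vec e u) r $ p)"
    by (simp add: scalar_prod_def lessThan_atLeast0)
  also have "\<dots> = (\<Sum>p<?n ^ r. (\<Prod>j<r. vec_nth u (map e (mindex ?n r p) ! j)) * A (map e (mindex ?n r p)))"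
  proof (intro sum.cong refl)
    fix p assume "p \<in> {..<?n ^ r}"
    then have p: "p < ?n ^ r" by simp
    have "mindex ?n r p ! j < ?n" if "j < r" for j
      using that by (simp add: mindex_nth)
    then have "kron_power (coord_vec e u) r $ p = (\<Prod>j<r. vec_nth u (map e (mindex ?n r p) ! j))"
      unfolding kron_power_def kron_list_nth[OF vs p] by (intro prod.cong) (auto simp: coord_vec_def)
    then show "a $ p * kron_power (coord_vec e u) r $ p =
        (\<Prod>j<r. vec_nth u (map e (mindex ?n r p) ! j)) * A (map e (mindex ?n r p))"
      using A[OF p] by simp
  qed
  also have "\<dots> = (\<Sum>is | length is = r. (\<Prod>j<r. vec_nth u (is ! j)) * A is)"
    by (rule sum.reindex_bij_betw[OF bij_betw_map_mindex[OF e]])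
  finally show ?thesis .
qed

lemma permute_list_eq_iff:
  assumes \<sigma>: "\<sigma> permutes {..<length xs}"
  shows "permute_list \<sigma> xs = ys \<longleftrightarrow> xs = permute_list (inv_into UNIV \<sigma>) ys"
proof -
  have inv: "inv_into UNIV \<sigma> permutes {..<length xs}" by (rule permutes_inv[OF \<sigma>])
  have 1: "permute_list (inv_into UNIV \<sigma>) (permute_list \<sigma> xs) = xs"
    using permute_list_compose[OF inv, of \<sigma>] permutes_inv_o[OF \<sigma>] by simp
  have 2: "permute_list \<sigma> (permute_list (inv_into UNIV \<sigma>) ys) = ys" if "length xs = length ys"
    using permute_list_compose[of \<sigma> ys "inv_into UNIV \<sigma>"] permutes_inv_o[OF \<sigma>] \<sigma> that by simp
  show ?thesis using 1 2 by (metis length_permute_list)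
qed

text \<open>
  Column \<open>q\<close> of the symmetrizer is its value on the unit vector at \<open>q\<close>, which is the Kronecker
  product of the unit vectors selected by the digits of \<open>q\<close>; so the defining equation gives it.
\<close>

lemma symmetrizer_entry:
  assumes p: "p < d ^ r" and q: "q < d ^ r"
  shows "fact r * symmetrizer d r $$ (p, q) =
    (\<Sum>\<sigma> | \<sigma> permutes {..<r}. if permute_list \<sigma> (mindex d r q) = mindex d r p then 1 else 0)"
proof -
  let ?S = "symmetrizer d r" and ?P = "{\<sigma>. \<sigma> permutes {..<r}}" and ?m = "mindex d r"
  have S: "is_symmetrizer d r ?S"
    unfolding symmetrizer_def by (rule theI'[OF ex1_symmetrizer])
  then have car: "?S \<in> carrier_mat (d ^ r) (d ^ r)" by (simp add: is_symmetrizer_def)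
  let ?vs = "map (unit_vec d) (?m q) :: real Matrix.vec list"
  let ?k = "\<lambda>\<sigma>. kron_list (map (\<lambda>j. ?vs ! \<sigma> j) [0..<r])"
  have bound: "?m x ! j < d" if "j < r" "x < d ^ r" for j x
    using that by (cases "d = 0") (auto simp: mindex_nth power_0_left)
  have perm: "\<sigma> j < r" if "\<sigma> permutes {..<r}" "j < r" for \<sigma> j
    using permutes_in_image[OF that(1), of j] that(2) by simp
  have vs: "set (map (\<lambda>j. ?vs ! \<sigma> j) [0..<r]) \<subseteq> carrier_vec d" if "\<sigma> permutes {..<r}" for \<sigma>
    using perm[OF that] by auto
  have kcar: "?k \<in> ?P \<rightarrow> carrier_vec (d ^ r)"
    using kron_list_carrier[OF vs] by auto
  have "length ?vs = r \<and> set ?vs \<subseteq> carrier_vec d" by auto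
  then have "fact r \<cdot>\<^sub>v (?S *\<^sub>v kron_list ?vs) = finsum_vec TYPE(real) (d ^ r) ?k ?P"
    using S unfolding is_symmetrizer_def by blast
  then have "(fact r \<cdot>\<^sub>v (?S *\<^sub>v unit_vec (d ^ r) q)) $ p = finsum_vec TYPE(real) (d ^ r) ?k ?P $ p"
    by (simp add: kron_list_unit_vecs[OF q])
  also have "\<dots> = (\<Sum>\<sigma>\<in>?P. ?k \<sigma> $ p)"
    using p kcar by (intro index_finsum_vec finite_permutations) auto
  also have "\<dots> = (\<Sum>\<sigma>\<in>?P. if permute_list \<sigma> (?m q) = ?m p then 1 else 0)"
  proof (intro sum.cong refl)
    fix \<sigma> assume "\<sigma> \<in> ?P"
    then have \<sigma>: "\<sigma> permutes {..<r}" by simp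
    have "?k \<sigma> $ p = (\<Prod>j<r. map (\<lambda>j. ?vs ! \<sigma> j) [0..<r] ! j $ (?m p ! j))"
      using vs[OF \<sigma>] p by (intro kron_list_nth) auto
    also have "\<dots> = (\<Prod>j<r. if permute_list \<sigma> (?m q) ! j = ?m p ! j then 1 else 0)"
      using perm[OF \<sigma>] bound p q by (intro prod.cong) (auto simp: permute_list_def)
    also have "\<dots> = (if permute_list \<sigma> (?m q) = ?m p then 1 else 0)"
      by (auto simp: list_eq_iff_nth_eq)
    finally show "?k \<sigma> $ p = (if permute_list \<sigma> (?m q) = ?m p then 1 else 0)" .
  qed
  finally show ?thesis using car p q by simp
qed

text \<open>
  In the sum over \<open>q\<close>, each permutation \<open>\<sigma>\<close> selects the single multi-index obtained from that
  of \<open>p\<close> by the inverse of \<open>\<sigma>\<close>; summing over inverses is the same as summing over permutations.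
\<close>

lemma symmetrizer_mult_vec:
  assumes a: "a \<in> carrier_vec (d ^ r)"
    and A: "\<And>q. q < d ^ r \<Longrightarrow> a $ q = A (mindex d r q)"
    and p: "p < d ^ r"
  shows "fact r * (symmetrizer d r *\<^sub>v a) $ p =
    (\<Sum>\<sigma> | \<sigma> permutes {..<r}. A (permute_list \<sigma> (mindex d r p)))"
proof -
  let ?S = "symmetrizer d r" and ?P = "{\<sigma>. \<sigma> permutes {..<r}}" and ?m = "mindex d r"
  let ?L = "{is. set is \<subseteq> {..<d} \<and> length is = r}"
  have car: "?S \<in> carrier_mat (d ^ r) (d ^ r)"
    using theI'[OF ex1_symmetrizer, of d r] by (simp add: symmetrizer_def is_symmetrizer_def)
  have mp: "?m p \<in> ?L" using bij_betw_apply[OF bij_betw_mindex] p by blast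
  have fin: "finite ?L" by (simp add: finite_lists_length_eq)
  have "fact r * (?S *\<^sub>v a) $ p = (\<Sum>q<d ^ r. (fact r * ?S $$ (p, q)) * a $ q)"
    using car a p by (simp add: scalar_prod_def lessThan_atLeast0 sum_distrib_left mult.assoc)
  also have "\<dots> = (\<Sum>q<d ^ r. \<Sum>\<sigma>\<in>?P. if permute_list \<sigma> (?m q) = ?m p then A (?m q) else 0)"
    using p A by (intro sum.cong refl) (auto simp: symmetrizer_entry sum_distrib_right intro!: sum.cong)
  also have "\<dots> = (\<Sum>\<sigma>\<in>?P. \<Sum>q<d ^ r. if permute_list \<sigma> (?m q) = ?m p then A (?m q) else 0)"
    by (rule sum.swap)
  also have "\<dots> = (\<Sum>\<sigma>\<in>?P. A (permute_list (inv_into UNIV \<sigma>) (?m p)))"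
  proof (intro sum.cong refl)
    fix \<sigma> assume "\<sigma> \<in> ?P"
    then have \<sigma>: "\<sigma> permutes {..<r}" by simp
    have "(\<Sum>q<d ^ r. if permute_list \<sigma> (?m q) = ?m p then A (?m q) else 0) =
        (\<Sum>is\<in>?L. if permute_list \<sigma> is = ?m p then A is else 0)"
      by (rule sum.reindex_bij_betw[OF bij_betw_mindex])
    also have "\<dots> = (\<Sum>is\<in>?L. if is = permute_list (inv_into UNIV \<sigma>) (?m p) then A is else 0)"
      using \<sigma> by (intro sum.cong refl) (auto simp: permute_list_eq_iff)
    also have "\<dots> = A (permute_list (inv_into UNIV \<sigma>) (?m p))"
      using fin mp permutes_inv[OF \<sigma>] by simp
    finally show "(\<Sum>q<d ^ r. if permute_list \<sigma> (?m q) = ?m p then A (?m q) else 0) =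
        A (permute_list (inv_into UNIV \<sigma>) (?m p))" .
  qed
  also have "\<dots> = (\<Sum>\<sigma>\<in>?P. A (permute_list \<sigma> (?m p)))"
    by (rule sum_permutations_inverse[symmetric])
  finally show ?thesis .
qed

section \<open>The differential and the vectorized derivative\<close>

theorem theorem1:
  fixes f :: "real^'d::finite \<Rightarrow> real" and c :: "real^'d" and r :: nat and e :: "nat \<Rightarrow> 'd"
  assumes "bij_betw e {..<CARD('d)} (UNIV :: 'd set)"
    and "r \<ge> 1"
    and "times_differentiable_at r f c"
  shows "(\<forall>u :: real^'d. differential r f c u = vec_deriv e r f c \<bullet> kron_power (coord_vec e u) r) \<and>
    (\<forall>a \<in> carrier_vec (CARD('d) ^ r).
      (\<forall>u :: real^'d. differential r f c u = a \<bullet> kron_power (coord_vec e u) r) \<longrightarrow>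
      vec_deriv e r f c = symmetrizer CARD('d) r *\<^sub>v a)"
proof (intro conjI ballI allI impI)
  fix u :: "real^'d"
  show "differential r f c u = vec_deriv e r f c \<bullet> kron_power (coord_vec e u) r"
    unfolding differential_def
    by (rule scalar_prod_kron_power[OF assms(1), symmetric]) (simp_all add: vec_deriv_def)
next
  let ?n = "CARD('d)" and ?m = "mindex CARD('d) r" and ?P = "{\<sigma>. \<sigma> permutes {..<r}}"
  fix a :: "real Matrix.vec"
  assume a: "a \<in> carrier_vec (?n ^ r)"
    and eq: "\<forall>u :: real^'d. differential r f c u = a \<bullet> kron_power (coord_vec e u) r"
  \<comment> \<open>The two coefficient arrays, indexed by lists of coordinate labels; \<open>A\<close> is read off
    from \<open>a\<close> through the inverse of the map from positions to multi-indices.\<close>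
  define H where "H is = partial_derivs is f c" for "is"
  define A where "A is = a $ inv_into {..<?n ^ r} (\<lambda>p. map e (?m p)) is" for "is"
  have A: "a $ p = A (map e (?m p))" if "p < ?n ^ r" for p
    unfolding A_def
    using bij_betw_inv_into_left[OF bij_betw_map_mindex[OF assms(1)], of p r] that by simp
  have zero: "(\<Sum>is | length is = r. (\<Prod>j<r. u (is ! j)) * (H is - A is)) = 0" for u :: "'d \<Rightarrow> real"
  proof -
    have "(\<Sum>is | length is = r. (\<Prod>j<r. vec_nth (vec_lambda u) (is ! j)) * H is) =
        (\<Sum>is | length is = r. (\<Prod>j<r. vec_nth (vec_lambda u) (is ! j)) * A is)"
      using eq[rule_format, of "vec_lambda u"] scalar_prod_kron_power[OF assms(1) a A]
      by (simp add: differential_def H_def)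
    then show ?thesis by (simp add: right_diff_distrib sum_subtractf)
  qed
  have carS: "symmetrizer ?n r \<in> carrier_mat (?n ^ r) (?n ^ r)"
    using theI'[OF ex1_symmetrizer, of ?n r] by (simp add: symmetrizer_def is_symmetrizer_def)
  show "vec_deriv e r f c = symmetrizer ?n r *\<^sub>v a"
  proof (rule eq_vecI)
    show "dim_vec (vec_deriv e r f c) = dim_vec (symmetrizer ?n r *\<^sub>v a)"
      using carS by (simp add: vec_deriv_def)
    fix p assume "p < dim_vec (symmetrizer ?n r *\<^sub>v a)"
    then have p: "p < ?n ^ r" using carS by simp
    let ?is = "map e (?m p)"
    have "fact r * (symmetrizer ?n r *\<^sub>v a) $ p = (\<Sum>\<sigma>\<in>?P. A (map e (permute_list \<sigma> (?m p))))"
      using A by (intro symmetrizer_mult_vec[OF a _ p, where A = "\<lambda>js. A (map e js)"]) auto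
    also have "\<dots> = (\<Sum>\<sigma>\<in>?P. A (permute_list \<sigma> ?is))"
      by (intro sum.cong refl) (simp add: permute_list_map)
    also have "\<dots> = (\<Sum>\<sigma>\<in>?P. H (permute_list \<sigma> ?is))"
      using symmetrization_zero_if_diagonal_zero[OF zero, of ?is] by (simp add: sum_subtractf)
    also have "\<dots> = (\<Sum>\<sigma>\<in>?P. H ?is)"
      unfolding H_def
      by (intro sum.cong refl partial_derivs_mset_cong[OF assms(3)]) auto
    also have "\<dots> = fact r * vec_deriv e r f c $ p"
      using p by (simp add: card_permutations vec_deriv_def H_def)
    finally show "vec_deriv e r f c $ p = (symmetrizer ?n r *\<^sub>v a) $ p" by simp
  qed
qed

end
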